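(* Let $X$ be a real Banach space that contains no isomorphic copy of $\ell^1$ and let $B$ be a boundary for $X$. If $A\subseteq X$ is bounded and $\varepsilon\geq 0$ are such that for each sequence $(x_n)_{n\in\mathbb{N}}$ in $A$ we have $$\bigcap_{k=1}^{\infty}\left(\overline{\operatorname{co}}^{\sigma_B}\{x_n : n\geq k\}+\varepsilon B_X\right)\neq\emptyset,$$ then $A$ is $2\varepsilon$-WRC.
   Context: $B_X$ is the closed unit ball of $X$, $X^*$ its dual and $S_{X^*}$ the unit sphere of $X^*$. A subset $B\subseteq S_{X^*}$ is a boundary for $X$ if for every $x\in X$ there is some $b\in B$ with $b(x)=\|x\|$. $\sigma_B$ denotes the topology on $X$ of pointwise convergence on $B$; $\overline{\operatorname{co}}^{\sigma_B} C$ is the $\sigma_B$-closure of the convex hull of $C$. For $\delta\geq 0$, a bounded set $A\subseteq X$ is $\delta$-weakly relatively compact ($\delta$-WRC) if $\operatorname{dist}(x^{**},X)\leq\delta$ for every $x^{**}$ in the weak*-closure of $A$ in $X^{**}$ (with $X$ canonically embedded in $X^{**}$, and the distance taken in the norm of $X^{**}$). *)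

theory Defs
  imports "HOL-Analysis.Analysis"
begin

typedef ell1 = "{f :: nat \<Rightarrow> real. summable (\<lambda>n. \<bar>f n\<bar>)}"
  morphisms ell1_nth Abs_ell1
  by (rule exI[of _ "\<lambda>_. 0"]) simp

lemma summable_abs_add:
  fixes f g :: "nat \<Rightarrow> real"
  assumes "summable (\<lambda>n. \<bar>f n\<bar>)" "summable (\<lambda>n. \<bar>g n\<bar>)"
  shows "summable (\<lambda>n. \<bar>f n + g n\<bar>)"
  by (rule summable_comparison_test[OF _ summable_add[OF assms]]) auto

setup_lifting type_definition_ell1

instantiation ell1 :: real_normed_vector
begin

lift_definition zero_ell1 :: ell1 is "\<lambda>_. 0" by simp

lift_definition plus_ell1 :: "ell1 \<Rightarrow> ell1 \<Rightarrow> ell1" is "\<lambda>f g n. f n + g n"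
  by (rule summable_abs_add)

lift_definition minus_ell1 :: "ell1 \<Rightarrow> ell1 \<Rightarrow> ell1" is "\<lambda>f g n. f n - g n"
  proof -
  fix f g :: "nat \<Rightarrow> real"
  assume "summable (\<lambda>n. \<bar>f n\<bar>)" "summable (\<lambda>n. \<bar>g n\<bar>)"
  then show "summable (\<lambda>n. \<bar>f n - g n\<bar>)"
    using summable_abs_add[of f "\<lambda>n. - g n"] by simp
qed

lift_definition uminus_ell1 :: "ell1 \<Rightarrow> ell1" is "\<lambda>f n. - f n" by simp

lift_definition scaleR_ell1 :: "real \<Rightarrow> ell1 \<Rightarrow> ell1" is "\<lambda>r f n. r * f n"
  by (simp add: abs_mult summable_mult)

lift_definition norm_ell1 :: "ell1 \<Rightarrow> real" is "\<lambda>f. \<Sum>n. \<bar>f n\<bar>" .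

definition dist_ell1 :: "ell1 \<Rightarrow> ell1 \<Rightarrow> real"
  where "dist_ell1 f g = norm (f - g)"

definition sgn_ell1 :: "ell1 \<Rightarrow> ell1"
  where "sgn_ell1 f = inverse (norm f) *\<^sub>R f"

definition uniformity_ell1 :: "(ell1 \<times> ell1) filter"
  where "uniformity_ell1 = (INF e\<in>{0<..}. principal {(x, y). dist x y < e})"

definition open_ell1 :: "ell1 set \<Rightarrow> bool"
  where "open_ell1 U = (\<forall>x\<in>U. \<forall>\<^sub>F (x', y) in uniformity. x' = x \<longrightarrow> y \<in> U)"

instance
proof
  fix f g h :: ell1 and a b :: real and U :: "ell1 set"
  show "f + g + h = f + (g + h)" "f + g = g + f" "0 + f = f" "- f + f = 0" "f - g = f + - g"
    by (transfer, simp add: add_ac fun_eq_iff)+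
  show "a *\<^sub>R (f + g) = a *\<^sub>R f + a *\<^sub>R g" "(a + b) *\<^sub>R f = a *\<^sub>R f + b *\<^sub>R f"
    "a *\<^sub>R b *\<^sub>R f = (a * b) *\<^sub>R f" "1 *\<^sub>R f = f"
    by (transfer, simp add: algebra_simps fun_eq_iff)+
  show "dist f g = norm (f - g)" "sgn f = inverse (norm f) *\<^sub>R f"
    by (simp_all add: dist_ell1_def sgn_ell1_def)
  show "uniformity = (INF e\<in>{0<..}. principal {(x, y :: ell1). dist x y < e})"
    by (fact uniformity_ell1_def)
  show "open U = (\<forall>x\<in>U. \<forall>\<^sub>F (x', y) in uniformity. x' = x \<longrightarrow> y \<in> U)"
    by (fact open_ell1_def)
  show "norm f = 0 \<longleftrightarrow> f = 0"
    by transfer (auto simp: suminf_eq_zero_iff fun_eq_iff)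
  show "norm (f + g) \<le> norm f + norm g"
  proof transfer
    fix f g :: "nat \<Rightarrow> real"
    assume f: "summable (\<lambda>n. \<bar>f n\<bar>)" and g: "summable (\<lambda>n. \<bar>g n\<bar>)"
    have fg: "summable (\<lambda>n. \<bar>f n + g n\<bar>)"
      by (rule summable_abs_add[OF f g])
    have "(\<Sum>n. \<bar>f n + g n\<bar>) \<le> (\<Sum>n. \<bar>f n\<bar> + \<bar>g n\<bar>)"
      by (rule suminf_le[OF _ fg summable_add[OF f g]]) simp
    then show "(\<Sum>n. \<bar>f n + g n\<bar>) \<le> (\<Sum>n. \<bar>f n\<bar>) + (\<Sum>n. \<bar>g n\<bar>)"
      by (simp add: suminf_add[OF f g])
  qed
  show "norm (a *\<^sub>R f) = \<bar>a\<bar> * norm f"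
    by transfer (simp add: abs_mult suminf_mult)
qed

end

definition contains_copy_of_ell1 :: "'a::real_normed_vector itself \<Rightarrow> bool"
  where "contains_copy_of_ell1 _ \<longleftrightarrow>
    (\<exists>(T :: ell1 \<Rightarrow> 'a) S. bounded_linear T \<and> homeomorphism UNIV (range T) T S)"

definition is_boundary :: "('a::real_normed_vector \<Rightarrow>\<^sub>L real) set \<Rightarrow> bool"
  where "is_boundary B \<longleftrightarrow>
    B \<subseteq> sphere 0 1 \<and> (\<forall>x. \<exists>b\<in>B. blinfun_apply b x = norm x)"

definition sigma_topology :: "('a::real_normed_vector \<Rightarrow>\<^sub>L real) set \<Rightarrow> 'a topology"
  where "sigma_topology B =
    pullback_topology UNIV (\<lambda>x. \<lambda>b\<in>B. blinfun_apply b x)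
      (product_topology (\<lambda>_. euclideanreal) B)"

definition bidual_embedding :: "'a::real_normed_vector \<Rightarrow> (('a \<Rightarrow>\<^sub>L real) \<Rightarrow>\<^sub>L real)"
  where "bidual_embedding x = Blinfun (\<lambda>f. blinfun_apply f x)"

lemma bidual_embedding_apply [simp]:
  "blinfun_apply (bidual_embedding x) f = blinfun_apply f x"
  unfolding bidual_embedding_def
  by (simp add: bounded_linear_Blinfun_apply blinfun.bounded_linear_left)

(* On a space of functionals, the strong operator topology (pointwise convergence with
   respect to the norm of the codomain, here real) is the weak* topology. *)
abbreviation weak_star_topology :: "('b::real_normed_vector \<Rightarrow>\<^sub>L real) topology"
  where "weak_star_topology \<equiv> strong_operator_topology"

definition weakly_relatively_compact_upto :: "real \<Rightarrow> 'a::real_normed_vector set \<Rightarrow> bool"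
  where "weakly_relatively_compact_upto \<delta> A \<longleftrightarrow>
    bounded A \<and>
    (\<forall>z \<in> weak_star_topology closure_of (bidual_embedding ` A).
       infdist z (range bidual_embedding) \<le> \<delta>)"

end

theory Submission
  imports Defs "HOL-Library.Diagonal_Subsequence"
begin

text \<open>
  Let \<open>z\<close> be in the weak* closure of \<open>A\<close> and let \<open>d\<close> be its distance to \<open>X\<close>. The weak* closure
  supplies points \<open>x\<^sub>n\<close> of \<open>A\<close> and Helly's theorem supplies functionals \<open>f\<^sub>m\<close> in the dual unit ball
  such that \<open>f\<^sub>m(x\<^sub>n)\<close> tends to \<open>z(f\<^sub>m)\<close> for fixed \<open>m\<close>, with \<open>z(f\<^sub>m) > d - 1 / (m + 1)\<close>,
  while it tends to \<open>0\<close> as \<open>m\<close> grows with \<open>n\<close> fixed (\<open>double_limit_sequences\<close>). Both properties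
  survive passage to a subsequence \<open>y\<close> of \<open>x\<close>.

  Since \<open>X\<close> contains no copy of \<open>\<ell>\<^sup>1\<close>, Rosenthal's theorem (\<open>rosenthal_ell1\<close>) makes \<open>y\<close> weakly
  Cauchy. A point \<open>x\<^sub>0\<close> of the nonempty intersection then satisfies
  \<open>\<bar>b(x\<^sub>0) - lim b(y\<^sub>n)\<bar> \<le> \<epsilon>\<close> for all \<open>b\<close> in the boundary. Without weak Cauchyness \<open>b(x\<^sub>0)\<close> would
  only be controlled by \<open>liminf\<close> and \<open>limsup\<close> of \<open>b(y\<^sub>n)\<close>, which may be far apart.

  The bound on the boundary is turned into a norm estimate by Simons' inequality
  (\<open>simons_inequality\<close>), applied to the tails of \<open>y\<^sub>n - x\<^sub>0\<close>: for every \<open>k\<close> some convex combination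
  \<open>u\<^sub>k\<close> of \<open>{y\<^sub>n | n \<ge> k}\<close> is within \<open>\<epsilon> + \<eta> / 2\<close> of \<open>x\<^sub>0\<close>. Hence \<open>\<parallel>u\<^sub>m - u\<^sub>0\<parallel> \<le> 2\<epsilon> + \<eta>\<close>. But
  \<open>f\<^sub>m(u\<^sub>0)\<close> tends to \<open>0\<close> and \<open>f\<^sub>m(u\<^sub>m)\<close> is at least \<open>d\<close> in the limit, so \<open>d \<le> 2\<epsilon> + \<eta>\<close>.
\<close>

section \<open>Oscillating sequences of pairs of sets\<close>

text \<open>
  The sets \<open>P n\<close> and \<open>Q n\<close> stand for \<open>{t. g\<^sub>n(t) \<le> r}\<close> and \<open>{t. g\<^sub>n(t) \<ge> s}\<close> with \<open>r < s\<close> and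
  functions \<open>g\<^sub>n\<close>. The sequence \<open>(g\<^sub>n)\<close>, \<open>n \<in> L\<close>, is settled on \<open>C\<close> if at no point of \<open>C\<close> it
  crosses the gap between \<open>r\<close> and \<open>s\<close> infinitely often.
\<close>

definition settled_on :: "(nat \<Rightarrow> 't set) \<Rightarrow> (nat \<Rightarrow> 't set) \<Rightarrow> nat set \<Rightarrow> 't set \<Rightarrow> bool"
  where "settled_on P Q L C \<longleftrightarrow>
    (\<forall>t\<in>C. finite {n\<in>L. t \<in> P n} \<or> finite {n\<in>L. t \<in> Q n})"

definition oscillating_on :: "(nat \<Rightarrow> 't set) \<Rightarrow> (nat \<Rightarrow> 't set) \<Rightarrow> nat set \<Rightarrow> 't set \<Rightarrow> bool"
  where "oscillating_on P Q M C \<longleftrightarrow> (\<forall>L\<subseteq>M. infinite L \<longrightarrow> \<not> settled_on P Q L C)"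

lemma oscillating_on_subset:
  "oscillating_on P Q M C \<Longrightarrow> M' \<subseteq> M \<Longrightarrow> oscillating_on P Q M' C"
  unfolding oscillating_on_def by blast

lemma oscillating_on_nonempty:
  "oscillating_on P Q M C \<Longrightarrow> infinite M \<Longrightarrow> C \<noteq> {}"
  unfolding oscillating_on_def settled_on_def by blast

lemma settled_on_cofinite:
  assumes "settled_on P Q M C" "L \<subseteq> M \<union> F" "finite F"
  shows "settled_on P Q L C"
  unfolding settled_on_def
proof
  have *: "finite {n\<in>L. t \<in> R n}" if "finite {n\<in>M. t \<in> R n}" for t and R :: "nat \<Rightarrow> 'a set"
    by (rule finite_subset[of _ "{n\<in>M. t \<in> R n} \<union> F"]) (use that assms in auto)
  fix t assume "t \<in> C"
  then show "finite {n\<in>L. t \<in> P n} \<or> finite {n\<in>L. t \<in> Q n}"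
    using assms(1) * unfolding settled_on_def by meson
qed

text \<open>
  The combinatorial core of Rosenthal's theorem. If the splitting failed for every \<open>j\<close>, one could
  choose successively \<open>j\<^sub>0 < j\<^sub>1 < \<dots>\<close> together with shrinking index sets that settle on one of the
  two halves of some member of \<open>\<C>\<close> at each step. Infinitely many of the choices concern the same
  \<open>C\<close> and the same half, say \<open>C \<inter> P j\<^sub>k\<close>. The set \<open>L\<close> of these \<open>j\<^sub>k\<close> then settles on each of them.
  A point of \<open>C\<close> outside all the \<open>P j\<^sub>k\<close> cannot oscillate along \<open>L\<close> either, so \<open>L\<close> settles on
  \<open>C\<close>, contrary to oscillation.
\<close>

lemma oscillating_on_split:
  assumes fin: "finite \<C>" and inf: "infinite M"
    and osc: "\<And>C. C \<in> \<C> \<Longrightarrow> oscillating_on P Q M C"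
  shows "\<exists>j\<in>M. \<exists>M'\<subseteq>M. infinite M' \<and>
    (\<forall>C\<in>\<C>. oscillating_on P Q M' (C \<inter> P j) \<and> oscillating_on P Q M' (C \<inter> Q j))"
proof (rule ccontr)
  assume neg: "\<not> ?thesis"
  define S where "S \<sigma> j = (if \<sigma> then P j else Q j)" for \<sigma> j
  have step: "\<exists>C\<in>\<C>. \<exists>\<sigma>. \<exists>L\<subseteq>M'. infinite L \<and> settled_on P Q L (C \<inter> S \<sigma> j)"
    if "j \<in> M" "M' \<subseteq> M" "infinite M'" for j M'
  proof -
    obtain C where C: "C \<in> \<C>"
      "\<not> oscillating_on P Q M' (C \<inter> P j) \<or> \<not> oscillating_on P Q M' (C \<inter> Q j)"
      using neg \<open>j \<in> M\<close> \<open>M' \<subseteq> M\<close> \<open>infinite M'\<close> by blast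
    then obtain \<sigma> where "\<not> oscillating_on P Q M' (C \<inter> S \<sigma> j)"
      unfolding S_def by (metis (full_types))
    with C(1) show ?thesis unfolding oscillating_on_def by blast
  qed
  \<comment> \<open>A state records the chosen index, the index set left for later choices, and the half of a
    member of \<open>\<C>\<close> on which this index set is settled.\<close>
  define good where "good s \<longleftrightarrow> (case s of (j, M', C, \<sigma>) \<Rightarrow>
      j \<in> M \<and> M' \<subseteq> M \<inter> {j<..} \<and> infinite M' \<and> C \<in> \<C> \<and> settled_on P Q M' (C \<inter> S \<sigma> j))" for s
  have next_ex: "\<exists>s. good s \<and> fst s \<in> N \<and> fst (snd s) \<subseteq> N" if N: "N \<subseteq> M" "infinite N" for N
  proof -
    obtain j where j: "j \<in> N" using infinite_imp_nonempty[OF N(2)] by blast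
    have "infinite (N \<inter> {j<..})"
      using N(2) by (metis Int_commute finite_atMost finite_Diff2 Diff_eq Compl_atMost)
    with step[of j "N \<inter> {j<..}"] j N(1) obtain C \<sigma> L
      where "C \<in> \<C>" "L \<subseteq> N \<inter> {j<..}" "infinite L" "settled_on P Q L (C \<inter> S \<sigma> j)" by blast
    then show ?thesis using j N(1)
      by (intro exI[of _ "(j, L, C, \<sigma>)"]) (auto simp: good_def)
  qed
  obtain s where s: "\<And>n. good (s n)"
      "\<And>n. fst (s (Suc n)) \<in> fst (snd (s n)) \<and> fst (snd (s (Suc n))) \<subseteq> fst (snd (s n))"
  proof -
    have "\<exists>s. \<forall>n. good (s n) \<and>
      (fst (s (Suc n)) \<in> fst (snd (s n)) \<and> fst (snd (s (Suc n))) \<subseteq> fst (snd (s n)))"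
    proof (rule dependent_nat_choice)
      show "\<exists>x. good x" using next_ex[of M] inf by blast
      show "\<exists>y. good y \<and> fst y \<in> fst (snd x) \<and> fst (snd y) \<subseteq> fst (snd x)" if "good x" for x
        using that by (intro next_ex) (auto simp: good_def split: prod.splits)
    qed
    then show ?thesis using that by blast
  qed
  define j N C \<sigma> where "j n = fst (s n)" and "N n = fst (snd (s n))"
    and "C n = fst (snd (snd (s n)))" and "\<sigma> n = snd (snd (snd (s n)))" for n
  have jM: "j n \<in> M" and NM: "N n \<subseteq> M \<inter> {j n<..}" and CC: "C n \<in> \<C>"
    and settled: "settled_on P Q (N n) (C n \<inter> S (\<sigma> n) (j n))" for n
    using s(1)[of n] by (cases "s n"; simp add: good_def j_def N_def C_def \<sigma>_def)+
  have jN: "j (Suc n) \<in> N n" and NN: "N (Suc n) \<subseteq> N n" for n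
    using s(2)[of n] unfolding j_def N_def by auto
  have jN': "j k \<in> N i" if "i < k" for i k
  proof -
    have "N (k - 1) \<subseteq> N i"
      by (rule lift_Suc_antimono_le[of N, OF NN]) (use that in simp)
    then show ?thesis using subsetD[OF _ jN[of "k - 1"]] that by simp
  qed
  have "j n < j (Suc n)" for n
    using jN[of n] NM[of n] by blast
  then have "strict_mono j"
    by (rule strict_monoI_Suc)
  have "finite (range (\<lambda>n. (C n, \<sigma> n)))"
    by (rule finite_subset[of _ "\<C> \<times> UNIV"]) (use fin CC in auto)
  then obtain k0 where "infinite {k. (C k, \<sigma> k) = (C k0, \<sigma> k0)}"
    using pigeonhole_infinite[of UNIV "\<lambda>n. (C n, \<sigma> n)"] by auto
  moreover define K where "K = {k. (C k, \<sigma> k) = (C k0, \<sigma> k0)}"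
  ultimately have K: "infinite K" by simp
  define L where "L = j ` K"
  have "infinite L" "L \<subseteq> M"
    using K jM \<open>strict_mono j\<close> unfolding L_def
    by (auto dest!: finite_imageD intro: strict_mono_imp_inj_on)
  have LN: "settled_on P Q L (C k0 \<inter> S (\<sigma> k0) (j k))" if "k \<in> K" for k
  proof (rule settled_on_cofinite)
    show "settled_on P Q (N k) (C k0 \<inter> S (\<sigma> k0) (j k))"
      using settled[of k] that by (simp add: K_def)
    show "L \<subseteq> N k \<union> j ` {..k}"
      unfolding L_def using jN'[of k] by (metis UnCI atMost_iff image_eqI image_subsetI not_le)
  qed simp
  have "settled_on P Q L (C k0)"
    unfolding settled_on_def
  proof (rule, rule ccontr)
    fix t assume t: "t \<in> C k0" and "\<not> (finite {n\<in>L. t \<in> P n} \<or> finite {n\<in>L. t \<in> Q n})"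
    then have inf: "infinite {n\<in>L. t \<in> P n}" "infinite {n\<in>L. t \<in> Q n}" by auto
    then have "infinite {n\<in>L. t \<in> S (\<sigma> k0) n}" by (cases "\<sigma> k0") (simp_all add: S_def)
    then obtain n where "n \<in> L" "t \<in> S (\<sigma> k0) n"
      using not_finite_existsD by blast
    then obtain k where "k \<in> K" "t \<in> S (\<sigma> k0) (j k)" unfolding L_def by blast
    then show False using LN[of k] t inf unfolding settled_on_def by blast
  qed
  then show False
    using osc[OF CC] \<open>infinite L\<close> \<open>L \<subseteq> M\<close> unfolding oscillating_on_def by blast
qed

text \<open>
  Splitting is applied repeatedly to the finite family of all cells
  \<open>C \<inter> W\<^sub>0 \<inter> \<dots> \<inter> W\<^sub>k\<close> with \<open>W\<^sub>i \<in> {P j\<^sub>i, Q j\<^sub>i}\<close>. Oscillation of every cell is preserved, and an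
  oscillating cell is nonempty.
\<close>

lemma independent_subsequence:
  assumes "oscillating_on P Q UNIV C"
  shows "\<exists>j. strict_mono j \<and> (\<forall>n (\<sigma> :: nat \<Rightarrow> bool). \<exists>t\<in>C. \<forall>i<n.
    (\<sigma> i \<longrightarrow> t \<in> P (j i)) \<and> (\<not> \<sigma> i \<longrightarrow> t \<in> Q (j i)))"
proof -
  define good where "good s \<longleftrightarrow> (case s of (j :: nat, M, \<C>) \<Rightarrow>
      M \<subseteq> {j<..} \<and> infinite M \<and> finite \<C> \<and> (\<forall>C\<in>\<C>. oscillating_on P Q M C))" for s
  define split where "split j \<C> = (\<lambda>C. C \<inter> P j) ` \<C> \<union> (\<lambda>C. C \<inter> Q j) ` \<C>" for j \<C>
  have next_ex: "\<exists>j \<in> M. \<exists>M'. M' \<subseteq> M \<and> good (j, M', split j \<C>)"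
    if "infinite M" "finite \<C>" "\<And>C. C \<in> \<C> \<Longrightarrow> oscillating_on P Q M C" for M \<C>
  proof -
    from oscillating_on_split[OF that(2,1,3)] obtain j M' where j: "j \<in> M" "M' \<subseteq> M" "infinite M'"
      "\<forall>C\<in>\<C>. oscillating_on P Q M' (C \<inter> P j) \<and> oscillating_on P Q M' (C \<inter> Q j)" by blast
    have "infinite (M' \<inter> {j<..})"
      using j(3) by (metis Int_commute finite_atMost finite_Diff2 Diff_eq Compl_atMost)
    then have "good (j, M' \<inter> {j<..}, split j \<C>)"
      using j(4) that(2) unfolding good_def split_def
      by (auto intro: oscillating_on_subset[where M = M'])
    with j(1,2) show ?thesis by blast
  qed
  define linked where "linked s s' \<longleftrightarrow> fst s' \<in> fst (snd s) \<and>
    snd (snd s') = split (fst s') (snd (snd s))" for s s' :: "nat \<times> nat set \<times> 'a set set"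
  have "\<exists>s. \<forall>n. (good (s n) \<and> (n = 0 \<longrightarrow> snd (snd (s n)) = split (fst (s n)) {C}))
      \<and> linked (s n) (s (Suc n))"
  proof (rule dependent_nat_choice)
    obtain j M where "good (j, M, split j {C})"
      using next_ex[of UNIV "{C}"] assms by auto
    then show "\<exists>x. good x \<and> ((0::nat) = 0 \<longrightarrow> snd (snd x) = split (fst x) {C})"
      by (intro exI[of _ "(j, M, split j {C})"]) simp
  next
    fix x and n :: nat
    assume "good x \<and> (n = 0 \<longrightarrow> snd (snd x) = split (fst x) {C})"
    then obtain j M \<C> where x: "x = (j, M, \<C>)" and "infinite M" "finite \<C>"
      "\<And>C. C \<in> \<C> \<Longrightarrow> oscillating_on P Q M C"
      unfolding good_def by (cases x) auto
    from next_ex[OF this(2-4)] obtain j' M' where "j' \<in> M" "good (j', M', split j' \<C>)" by blast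
    then show "\<exists>y. (good y \<and> (Suc n = 0 \<longrightarrow> snd (snd y) = split (fst y) {C})) \<and> linked x y"
      by (intro exI[of _ "(j', M', split j' \<C>)"]) (simp add: linked_def x)
  qed
  then obtain s where s: "\<And>n. good (s n)" "snd (snd (s 0)) = split (fst (s 0)) {C}"
    "\<And>n. linked (s n) (s (Suc n))" by blast
  define j where "j n = fst (s n)" for n
  have "strict_mono j"
  proof (rule strict_monoI_Suc)
    show "j n < j (Suc n)" for n
      using s(1)[of n] s(3)[of n] by (cases "s n") (auto simp: good_def linked_def j_def)
  qed
  moreover have "\<exists>t\<in>C. \<forall>i<n.
    (\<sigma> i \<longrightarrow> t \<in> P (j i)) \<and> (\<not> \<sigma> i \<longrightarrow> t \<in> Q (j i))" for n and \<sigma> :: "nat \<Rightarrow> bool"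
  proof -
    define W where "W i = (if \<sigma> i then P (j i) else Q (j i))" for i
    have split: "D \<inter> W i \<in> split (j i) \<C>" if "D \<in> \<C>" for i D \<C>
      using that unfolding split_def W_def by (cases "\<sigma> i") auto
    have "C \<inter> (\<Inter>i\<le>k. W i) \<in> snd (snd (s k))" for k
    proof (induction k)
      case 0
      show ?case using split[of C "{C}" 0] s(2) by (simp add: j_def)
    next
      case (Suc k)
      have "C \<inter> (\<Inter>i\<le>Suc k. W i) = C \<inter> (\<Inter>i\<le>k. W i) \<inter> W (Suc k)"
        by (simp add: atMost_Suc Int_ac)
      also have "\<dots> \<in> split (j (Suc k)) (snd (snd (s k)))"
        by (rule split[OF Suc])
      finally show ?case using s(3)[of k] unfolding linked_def j_def by simp
    qed
    moreover have "infinite (fst (snd (s n)))"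
      and "\<And>D. D \<in> snd (snd (s n)) \<Longrightarrow> oscillating_on P Q (fst (snd (s n))) D"
      using s(1)[of n] by (cases "s n"; simp add: good_def)+
    ultimately have "C \<inter> (\<Inter>i\<le>n. W i) \<noteq> {}"
      by (blast dest: oscillating_on_nonempty)
    then obtain t where t: "t \<in> C" "\<And>i. i \<le> n \<Longrightarrow> t \<in> W i" by blast
    have "(\<sigma> i \<longrightarrow> t \<in> P (j i)) \<and> (\<not> \<sigma> i \<longrightarrow> t \<in> Q (j i))" if "i < n" for i
      using t(2)[of i] that by (cases "\<sigma> i") (simp_all add: W_def)
    then show ?thesis using t(1) by blast
  qed
  ultimately show ?thesis by blast
qed

section \<open>Rosenthal's theorem\<close>

text \<open>
  A bounded sequence with a lower \<open>\<ell>\<^sup>1\<close>-estimate spans a copy of \<open>\<ell>\<^sup>1\<close>: the operator sending the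
  unit vectors to the \<open>x\<^sub>n\<close> is bounded, and the estimate passes from finite sums to limits and makes
  the inverse Lipschitz.
\<close>

lemma contains_copy_of_ell1I:
  fixes x :: "nat \<Rightarrow> 'a::banach"
  assumes K: "\<And>n. norm (x n) \<le> K" and "c > 0"
    and low: "\<And>n a. c * (\<Sum>i<n. \<bar>a i\<bar>) \<le> norm (\<Sum>i<n. a i *\<^sub>R x i)"
  shows "contains_copy_of_ell1 TYPE('a)"
proof -
  define T where "T f = (\<Sum>n. ell1_nth f n *\<^sub>R x n)" for f
  have abs: "summable (\<lambda>n. \<bar>ell1_nth f n\<bar>)" for f
    using ell1_nth[of f] by simp
  have bound: "norm (ell1_nth f n *\<^sub>R x n) \<le> \<bar>ell1_nth f n\<bar> * K" for f n
    using K[of n] by (simp add: mult_left_mono)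
  have summ_norm: "summable (\<lambda>n. norm (ell1_nth f n *\<^sub>R x n))" for f
    by (rule summable_comparison_test'[OF summable_mult2[OF abs[of f], of K]])
      (use bound in simp)
  have summ: "summable (\<lambda>n. ell1_nth f n *\<^sub>R x n)" for f
    by (rule summable_norm_cancel[OF summ_norm])
  have "bounded_linear T"
  proof (rule bounded_linear_intro)
    show "T (f + g) = T f + T g" for f g
      unfolding T_def by (simp add: plus_ell1.rep_eq scaleR_add_left suminf_add summ)
    show "T (r *\<^sub>R f) = r *\<^sub>R T f" for r f
      unfolding T_def by (simp add: scaleR_ell1.rep_eq suminf_scaleR_right[OF summ] flip: scaleR_scaleR)
    show "norm (T f) \<le> norm f * K" for f
    proof -
      have "norm (T f) \<le> (\<Sum>n. norm (ell1_nth f n *\<^sub>R x n))"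
        unfolding T_def by (rule summable_norm[OF summ_norm])
      also have "\<dots> \<le> (\<Sum>n. \<bar>ell1_nth f n\<bar> * K)"
        by (rule suminf_le[OF bound summ_norm summable_mult2[OF abs]])
      also have "\<dots> = norm f * K"
        by (simp add: norm_ell1.rep_eq suminf_mult2[OF abs])
      finally show ?thesis .
    qed
  qed
  then interpret T: bounded_linear T .
  have lower: "c * norm f \<le> norm (T f)" for f
  proof (rule LIMSEQ_le)
    show "(\<lambda>n. c * (\<Sum>i<n. \<bar>ell1_nth f i\<bar>)) \<longlonglongrightarrow> c * norm f"
      unfolding norm_ell1.rep_eq by (intro tendsto_mult_left summable_LIMSEQ abs)
    show "(\<lambda>n. norm (\<Sum>i<n. ell1_nth f i *\<^sub>R x i)) \<longlonglongrightarrow> norm (T f)"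
      unfolding T_def by (intro tendsto_norm summable_LIMSEQ summ)
  qed (use low in blast)
  have lipschitz: "norm (f - g) \<le> (1 / c) * norm (T f - T g)" for f g
    using lower[of "f - g"] \<open>c > 0\<close> by (simp add: T.diff field_simps)
  have "inj T"
  proof (rule injI)
    fix f g assume "T f = T g"
    then show "f = g" using lipschitz[of f g] by simp
  qed
  have "homeomorphism UNIV (range T) T (inv T)"
  proof (rule homeomorphismI)
    show "continuous_on UNIV T"
      by (rule linear_continuous_on[OF \<open>bounded_linear T\<close>])
    have "(1 / c)-lipschitz_on (range T) (inv T)"
      using lipschitz \<open>inj T\<close> \<open>c > 0\<close> by (auto simp: lipschitz_on_def dist_norm)
    then show "continuous_on (range T) (inv T)"
      by (rule lipschitz_on_continuous_on)
  qed (use \<open>inj T\<close> in auto)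
  with \<open>bounded_linear T\<close> show ?thesis
    unfolding contains_copy_of_ell1_def by blast
qed

text \<open>
  Independence of the level sets yields a lower \<open>\<ell>\<^sup>1\<close>-estimate: given coefficients \<open>a\<^sub>i\<close>, choose
  functionals \<open>f\<close> and \<open>g\<close> lying on opposite sides of the gap at every \<open>x\<^sub>i\<close>, arranged according to
  the sign of \<open>a\<^sub>i\<close>. Then \<open>f - g\<close> has norm at most \<open>2\<close> and is at least \<open>(s - r) \<Sum> \<bar>a\<^sub>i\<bar>\<close> on
  \<open>\<Sum> a\<^sub>i x\<^sub>i\<close>.
\<close>

lemma oscillating_functionals_imp_ell1:
  fixes x :: "nat \<Rightarrow> 'a::banach" and r s :: real
  assumes K: "\<And>n. norm (x n) \<le> K" and "r < s"
    and osc: "oscillating_on (\<lambda>n. {f. blinfun_apply f (x n) \<le> r})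
      (\<lambda>n. {f. blinfun_apply f (x n) \<ge> s}) UNIV (cball 0 1)"
  shows "contains_copy_of_ell1 TYPE('a)"
proof -
  obtain j :: "nat \<Rightarrow> nat" where
    j: "\<exists>f\<in>cball 0 1. \<forall>i<n. (\<sigma> i \<longrightarrow> blinfun_apply f (x (j i)) \<le> r) \<and>
      (\<not> \<sigma> i \<longrightarrow> blinfun_apply f (x (j i)) \<ge> s)" for n and \<sigma> :: "nat \<Rightarrow> bool"
    using independent_subsequence[OF osc] by auto
  show ?thesis
  proof (rule contains_copy_of_ell1I)
    show "norm ((x \<circ> j) n) \<le> K" for n using K by simp
    show "(s - r) / 2 > 0" using \<open>r < s\<close> by simp
    fix n and a :: "nat \<Rightarrow> real"
    obtain f where f: "norm f \<le> 1" "\<And>i. i < n \<Longrightarrow> a i < 0 \<Longrightarrow> blinfun_apply f (x (j i)) \<le> r"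
        "\<And>i. i < n \<Longrightarrow> \<not> a i < 0 \<Longrightarrow> blinfun_apply f (x (j i)) \<ge> s"
      using j[of n "\<lambda>i. a i < 0"] by fastforce
    obtain g where g: "norm g \<le> 1" "\<And>i. i < n \<Longrightarrow> a i < 0 \<Longrightarrow> blinfun_apply g (x (j i)) \<ge> s"
        "\<And>i. i < n \<Longrightarrow> \<not> a i < 0 \<Longrightarrow> blinfun_apply g (x (j i)) \<le> r"
      using j[of n "\<lambda>i. \<not> a i < 0"] by fastforce
    define v where "v = (\<Sum>i<n. a i *\<^sub>R (x \<circ> j) i)"
    have "(s - r) * (\<Sum>i<n. \<bar>a i\<bar>) = (\<Sum>i<n. (s - r) * \<bar>a i\<bar>)"
      by (simp add: sum_distrib_left)
    also have "\<dots> \<le> (\<Sum>i<n. a i * blinfun_apply (f - g) (x (j i)))"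
    proof (rule sum_mono)
      fix i assume "i \<in> {..<n}"
      then have i: "i < n" by simp
      show "(s - r) * \<bar>a i\<bar> \<le> a i * blinfun_apply (f - g) (x (j i))"
      proof (cases "a i < 0")
        case True
        then have "s - r \<le> - blinfun_apply (f - g) (x (j i))"
          using f(2)[OF i] g(2)[OF i] by (simp add: blinfun.diff_left)
        from mult_right_mono[OF this, of "\<bar>a i\<bar>"] True show ?thesis by (simp add: mult.commute)
      next
        case False
        then have "s - r \<le> blinfun_apply (f - g) (x (j i))"
          using f(3)[OF i] g(3)[OF i] by (simp add: blinfun.diff_left)
        from mult_right_mono[OF this, of "\<bar>a i\<bar>"] False show ?thesis by (simp add: mult.commute)
      qed
    qed
    also have "\<dots> = blinfun_apply (f - g) v"
      by (simp add: v_def blinfun.sum_right blinfun.scaleR_right)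
    also have "\<dots> \<le> norm (f - g) * norm v"
      using norm_blinfun[of "f - g" v] by simp
    also have "\<dots> \<le> 2 * norm v"
      using norm_triangle_ineq4[of f g] f(1) g(1) by (intro mult_right_mono) auto
    finally show "(s - r) / 2 * (\<Sum>i<n. \<bar>a i\<bar>) \<le> norm (\<Sum>i<n. a i *\<^sub>R (x \<circ> j) i)"
      unfolding v_def by simp
  qed
qed

lemma convergent_if_no_rational_gap:
  fixes X :: "nat \<Rightarrow> real"
  assumes "bounded (range X)"
    and gap: "\<And>r s :: rat. r < s \<Longrightarrow> finite {n. X n \<le> of_rat r} \<or> finite {n. X n \<ge> of_rat s}"
  shows "convergent X"
proof -
  obtain l \<rho> where \<rho>: "strict_mono \<rho>" and l: "(X \<circ> \<rho>) \<longlonglongrightarrow> l"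
    using bounded_imp_convergent_subsequence[OF assms(1)] by blast
  have inf: "infinite {n. R n}" if "\<forall>\<^sub>F n in sequentially. R (\<rho> n)" for R
  proof
    assume "finite {n. R n}"
    then have "finite (\<rho> -` {n. R n})"
      by (intro finite_vimageI strict_mono_imp_inj_on \<rho>)
    moreover have "finite {n. \<not> R (\<rho> n)}"
      using that by (simp add: eventually_cofinite flip: cofinite_eq_sequentially)
    ultimately have "finite (\<rho> -` {n. R n} \<union> {n. \<not> R (\<rho> n)})" by simp
    also have "\<rho> -` {n. R n} \<union> {n. \<not> R (\<rho> n)} = UNIV" by auto
    finally show False by simp
  qed
  have ev: "\<forall>\<^sub>F n in sequentially. R n" if "finite {n. \<not> R n}" for R
    using that by (simp add: eventually_cofinite flip: cofinite_eq_sequentially)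
  have "X \<longlonglongrightarrow> l"
  proof (rule order_tendstoI)
    fix a assume "a < l"
    then obtain r where r: "a < of_rat r" "of_rat r < l" using of_rat_dense by blast
    then obtain s where s: "of_rat r < (of_rat s :: real)" "of_rat s < l" using of_rat_dense by blast
    have "infinite {n. X n \<ge> of_rat s}"
      by (rule inf, rule eventually_mono[OF order_tendstoD(1)[OF l s(2)]]) simp
    then have "finite {n. X n \<le> of_rat r}"
      using gap[of r s] s(1) by (simp add: of_rat_less)
    then have "\<forall>\<^sub>F n in sequentially. \<not> X n \<le> of_rat r" by (intro ev) simp
    then show "\<forall>\<^sub>F n in sequentially. a < X n"
      by eventually_elim (use r(1) in simp)
  next
    fix a assume "a > l"
    then obtain s where s: "l < of_rat s" "of_rat s < a" using of_rat_dense by blast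
    then obtain r where r: "l < of_rat r" "of_rat r < (of_rat s :: real)" using of_rat_dense by blast
    have "infinite {n. X n \<le> of_rat r}"
      by (rule inf, rule eventually_mono[OF order_tendstoD(2)[OF l r(1)]]) simp
    then have "finite {n. X n \<ge> of_rat s}"
      using gap[of r s] r(2) by (simp add: of_rat_less)
    then have "\<forall>\<^sub>F n in sequentially. \<not> X n \<ge> of_rat s" by (intro ev) simp
    then show "\<forall>\<^sub>F n in sequentially. X n < a"
      by eventually_elim (use s(2) in simp)
  qed
  then show ?thesis by (rule convergentI)
qed

text \<open>
  For a single rational gap \<open>oscillating_functionals_imp_ell1\<close> provides a subsequence along which no
  functional of the unit ball crosses the gap infinitely often. This property is inherited by subsequences, so a
  diagonal subsequence has it for all rational gaps at once.
\<close>

theorem rosenthal_ell1: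
  fixes x :: "nat \<Rightarrow> 'a::banach"
  assumes no_ell1: "\<not> contains_copy_of_ell1 TYPE('a)" and bdd: "bounded (range x)"
  shows "\<exists>\<rho>. strict_mono \<rho> \<and>
    (\<forall>f :: 'a \<Rightarrow>\<^sub>L real. norm f \<le> 1 \<longrightarrow> convergent (\<lambda>n. blinfun_apply f (x (\<rho> n))))"
proof -
  obtain K where K: "\<And>n. norm (x n) \<le> K"
    using bdd by (auto simp: bounded_iff)
  define separated where "separated r q \<sigma> \<longleftrightarrow> (r < q \<longrightarrow> (\<forall>f :: 'a \<Rightarrow>\<^sub>L real. norm f \<le> 1 \<longrightarrow>
      finite {n. blinfun_apply f (x (\<sigma> n)) \<le> of_rat r} \<or>
      finite {n. blinfun_apply f (x (\<sigma> n)) \<ge> of_rat q}))"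
    for r q :: rat and \<sigma> :: "nat \<Rightarrow> nat"
  define P where "P k = (case from_nat k of (r, q) \<Rightarrow> separated r q)" for k
  have ex: "\<exists>\<tau>. strict_mono \<tau> \<and> separated r q (\<sigma> \<circ> \<tau>)" for r q and \<sigma> :: "nat \<Rightarrow> nat"
  proof (cases "r < q")
    case True
    define P' Q' :: "nat \<Rightarrow> ('a \<Rightarrow>\<^sub>L real) set" where
      "P' n = {f. blinfun_apply f ((x \<circ> \<sigma>) n) \<le> of_rat r}" and
      "Q' n = {f. blinfun_apply f ((x \<circ> \<sigma>) n) \<ge> of_rat q}" for n
    have "\<not> oscillating_on P' Q' UNIV (cball 0 1)"
      using oscillating_functionals_imp_ell1[of "x \<circ> \<sigma>" K "of_rat r" "of_rat q"] K True no_ell1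
      unfolding P'_def Q'_def by (auto simp: of_rat_less)
    then obtain L where L: "infinite L" "settled_on P' Q' L (cball 0 1)"
      unfolding oscillating_on_def by blast
    have fin: "finite {n. R (enumerate L n)}" if "finite {n\<in>L. R n}" for R
    proof -
      have "finite (enumerate L -` {n\<in>L. R n})"
        using that L(1) by (intro finite_vimageI strict_mono_imp_inj_on strict_mono_enumerate)
      also have "enumerate L -` {n\<in>L. R n} = {n. R (enumerate L n)}"
        using enumerate_in_set[OF L(1)] by auto
      finally show ?thesis .
    qed
    have "separated r q (\<sigma> \<circ> enumerate L)"
      using L(2) unfolding separated_def settled_on_def P'_def Q'_def
      by (auto dest!: fin)
    then show ?thesis using strict_mono_enumerate[OF L(1)] by blast
  next
    case False
    then show ?thesis by (intro exI[of _ id]) (simp add: separated_def strict_mono_def)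
  qed
  interpret subseqs P
    by unfold_locales (use ex in \<open>auto simp: P_def split: prod.splits\<close>)
  have stable: "P k (\<sigma> \<circ> \<tau>)" if "strict_mono \<tau>" "P k \<sigma>" for \<tau> k \<sigma>
  proof -
    have fin: "finite {n. R (\<tau> n)}" if "finite {n. R n}" for R
      using finite_vimageI[OF that strict_mono_imp_inj_on[OF \<open>strict_mono \<tau>\<close>]] by (simp add: vimage_def)
    show ?thesis using \<open>P k \<sigma>\<close> unfolding P_def separated_def
      by (fastforce dest: fin split: prod.splits)
  qed
  have sep: "separated r q diagseq" for r q
  proof -
    define k where "k = to_nat (r, q)"
    have "separated r q (diagseq \<circ> (+) (Suc k))"
      using diagseq_holds[of k, OF stable] by (simp add: P_def k_def)
    moreover have "finite {n. R n}" if "finite {n. R (Suc k + n)}" for R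
    proof (rule finite_subset)
      show "{n. R n} \<subseteq> {..k} \<union> (+) (Suc k) ` {n. R (Suc k + n)}"
      proof
        fix n assume "n \<in> {n. R n}"
        then show "n \<in> {..k} \<union> (+) (Suc k) ` {n. R (Suc k + n)}"
          by (cases "n \<le> k") (auto intro!: image_eqI[of _ _ "n - Suc k"])
      qed
    qed (use that in simp)
    ultimately show ?thesis unfolding separated_def by (auto simp del: add_Suc)
  qed
  have "convergent (\<lambda>n. blinfun_apply f (x (diagseq n)))" if "norm f \<le> 1" for f :: "'a \<Rightarrow>\<^sub>L real"
  proof (rule convergent_if_no_rational_gap)
    have "\<bar>blinfun_apply f (x n)\<bar> \<le> K" for n
      using norm_blinfun[of f "x n"] mult_right_mono[OF that norm_ge_zero[of "x n"]] K[of n] by simp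
    then show "bounded (range (\<lambda>n. blinfun_apply f (x (diagseq n))))"
      by (auto simp: bounded_iff)
  qed (use sep that in \<open>auto simp: separated_def\<close>)
  then show ?thesis using subseq_diagseq by blast
qed

section \<open>Simons' inequality\<close>

text \<open>
  Infinite convex combinations with geometric weights stay in the set: they are limits of the
  normalized partial sums.
\<close>

lemma geometric_average_in_closed_convex:
  fixes y :: "nat \<Rightarrow> 'a::banach"
  assumes C: "closed C" "convex C" "bounded C" and y: "\<And>n. y n \<in> C"
    and q: "0 < q" "q < 1"
  shows "summable (\<lambda>n. q ^ n *\<^sub>R y n)"
    and "(1 - q) *\<^sub>R (\<Sum>n. q ^ n *\<^sub>R y n) \<in> C"
proof -
  obtain K where K: "\<And>v. v \<in> C \<Longrightarrow> norm v \<le> K"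
    using C(3) by (auto simp: bounded_iff)
  show summ: "summable (\<lambda>n. q ^ n *\<^sub>R y n)"
  proof (rule summable_norm_cancel, rule summable_comparison_test')
    show "summable (\<lambda>n. q ^ n * K)"
      using q by (intro summable_mult2 summable_geometric) simp
    show "norm (norm (q ^ n *\<^sub>R y n)) \<le> q ^ n * K" for n
      using K[OF y[of n]] q by (simp add: mult_left_mono)
  qed
  define s where "s n = (\<Sum>i<Suc n. q ^ i)" for n
  have s_pos: "s n > 0" for n
    unfolding s_def using q by (intro sum_pos) auto
  have "(\<lambda>n. \<Sum>i<n. q ^ i) \<longlonglongrightarrow> 1 / (1 - q)"
    using geometric_sums[of q] q by (simp add: sums_def)
  then have s_lim: "s \<longlonglongrightarrow> 1 / (1 - q)"
    unfolding s_def by (rule LIMSEQ_Suc)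
  show "(1 - q) *\<^sub>R (\<Sum>n. q ^ n *\<^sub>R y n) \<in> C"
  proof (rule closed_sequentially[OF C(1)])
    show "inverse (s n) *\<^sub>R (\<Sum>i<Suc n. q ^ i *\<^sub>R y i) \<in> C" for n
    proof -
      have "(\<Sum>i<Suc n. (q ^ i / s n) *\<^sub>R y i) \<in> C"
      proof (rule convex_sum)
        show "(\<Sum>i<Suc n. q ^ i / s n) = 1"
          using s_pos[of n] unfolding sum_divide_distrib[symmetric] s_def[symmetric] by simp
      qed (use C y q s_pos[of n] in auto)
      then show ?thesis by (simp only: scaleR_sum_right scaleR_scaleR divide_inverse mult.commute)
    qed
    have "(\<lambda>n. inverse (s n) *\<^sub>R (\<Sum>i<Suc n. q ^ i *\<^sub>R y i))
        \<longlonglongrightarrow> inverse (1 / (1 - q)) *\<^sub>R (\<Sum>n. q ^ n *\<^sub>R y n)"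
      using q by (intro tendsto_scaleR tendsto_inverse s_lim LIMSEQ_Suc summable_LIMSEQ summ) auto
    then show "(\<lambda>n. inverse (s n) *\<^sub>R (\<Sum>i<Suc n. q ^ i *\<^sub>R y i))
        \<longlonglongrightarrow> (1 - q) *\<^sub>R (\<Sum>n. q ^ n *\<^sub>R y n)"
      by simp
  qed
qed

text \<open>
  Suppose all convex combinations of the \<open>w\<^sub>n\<close> have norm at least \<open>m\<close>. Choose \<open>y\<^sub>k\<close> in the closed
  convex hull \<open>C\<^sub>k\<close> of the \<open>k\<close>-th tail one after the other so that the norm of
  \<open>z\<^sub>k\<^sub>+\<^sub>1 = y\<^sub>0 + q y\<^sub>1 + \<dots> + q\<^sup>k y\<^sub>k\<close> is nearly minimal, and let \<open>x\<close> be the limit. The rest of the series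
  is a multiple of an element of \<open>C\<^sub>k\<close> that competes with \<open>y\<^sub>k\<close>, so minimality forces
  \<open>\<parallel>x\<parallel> - \<parallel>z\<^sub>k\<parallel>\<close> to decay no faster than \<open>q\<^sup>k\<close>. A functional \<open>b\<close> of the boundary attaining
  \<open>\<parallel>x\<parallel>\<close> must collect this surplus, and for small \<open>q\<close> nearly all of it comes from the term
  \<open>q\<^sup>k y\<^sub>k\<close>. Thus \<open>b(y\<^sub>k) > m'\<close> for every \<open>k\<close>, whereas \<open>b(w\<^sub>n) \<le> m'\<close> for all \<open>n\<close> from some \<open>N\<close> on forces
  \<open>b(y\<^sub>N) \<le> m'\<close>.
\<close>

theorem simons_inequality:
  fixes w :: "nat \<Rightarrow> 'a::banach"
  assumes boundary: "is_boundary B" and bdd: "bounded (range w)"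
    and ev: "\<And>b. b \<in> B \<Longrightarrow> \<exists>N. \<forall>n\<ge>N. blinfun_apply b (w n) \<le> m'"
    and "m' < m"
  shows "\<exists>u\<in>convex hull (range w). norm u < m"
proof (rule ccontr)
  assume "\<not> ?thesis"
  then have hull_ge: "m \<le> norm u" if "u \<in> convex hull (range w)" for u
    using that by force
  define C where "C k = closure (convex hull (w ` {k..}))" for k
  obtain M where M: "\<And>n. norm (w n) \<le> M"
    using bdd by (auto simp: bounded_iff)
  have "M \<ge> 0" using M[of 0] norm_ge_zero[of "w 0"] by linarith
  have C_minimal: "C k \<subseteq> S" if "closed S" "convex S" "\<And>n. n \<ge> k \<Longrightarrow> w n \<in> S" for k S
    unfolding C_def using that by (intro closure_minimal hull_minimal) auto
  have C_mem: "w k \<in> C k" for k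
    unfolding C_def by (intro closure_subset[THEN subsetD] hull_inc) simp
  have C: "closed (C k)" "convex (C k)" "bounded (C k)" for k
  proof -
    show "closed (C k)" "convex (C k)" by (simp_all add: C_def convex_closure)
    show "bounded (C k)"
      by (rule bounded_subset[OF bounded_cball C_minimal[of "cball 0 M"]]) (use M in auto)
  qed
  have C_antimono: "C l \<subseteq> C k" if "k \<le> l" for k l
    unfolding C_def using that by (intro closure_mono hull_mono) auto
  have C_norm: "norm v \<le> M" if "v \<in> C k" for v k
    using C_minimal[of "cball 0 M" k] M that by (auto simp: subset_iff)
  have C_ge: "m \<le> norm v" if "v \<in> C 0" for v
  proof -
    have "closure (convex hull range w) \<subseteq> {v. m \<le> norm v}"
      using hull_ge by (intro closure_minimal closed_Collect_le) (auto intro: continuous_intros)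
    then show ?thesis using that by (auto simp: C_def atLeast_0)
  qed
  define \<delta> where "\<delta> = (m - m') / 2"
  have "\<delta> > 0" using \<open>m' < m\<close> by (simp add: \<delta>_def)
  \<comment> \<open>The final contradiction needs \<open>q (\<delta> + M - m) < \<delta>\<close>; using \<open>\<bar>m\<bar>\<close> instead of \<open>- m\<close> also
    ensures \<open>q < 1\<close>.\<close>
  define q where "q = \<delta> / 2 / (\<delta> + M + \<bar>m\<bar>)"
  have q: "0 < q" "q < 1" "q * (\<delta> + M - m) < \<delta>"
  proof -
    have pos: "\<delta> + M + \<bar>m\<bar> > 0" using \<open>\<delta> > 0\<close> \<open>M \<ge> 0\<close> by linarith
    then show "0 < q" using \<open>\<delta> > 0\<close> by (simp add: q_def)
    show "q < 1" using pos \<open>\<delta> > 0\<close> \<open>M \<ge> 0\<close> by (simp add: q_def divide_less_eq)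
    have "q * (\<delta> + M - m) \<le> q * (\<delta> + M + \<bar>m\<bar>)"
      using \<open>0 < q\<close> by (intro mult_left_mono) auto
    also have "\<dots> = \<delta> / 2"
      unfolding q_def by (rule nonzero_eq_divide_eq[THEN iffD1]) (use pos in auto)
    finally show "q * (\<delta> + M - m) < \<delta>" using \<open>\<delta> > 0\<close> by simp
  qed
  define z where "z y k = (\<Sum>n<k. q ^ n *\<^sub>R y n)" for y :: "nat \<Rightarrow> 'a" and k
  \<comment> \<open>Tolerances small enough that, after division of \<open>e k\<close> by \<open>q ^ Suc k\<close>, they add up to at most \<open>\<delta>\<close>.\<close>
  define e where "e k = \<delta> * (q / 2) ^ Suc k" for k
  have e_pos: "e k > 0" for k using q \<open>\<delta> > 0\<close> by (simp add: e_def)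
  have "\<exists>y. \<forall>k. y k \<in> C k \<and> (\<forall>v\<in>C k. norm (z y k + q ^ k *\<^sub>R y k) \<le> norm (z y k + q ^ k *\<^sub>R v) + e k)"
  proof (rule dependent_wellorder_choice)
    fix r :: 'a and f g :: "nat \<Rightarrow> 'a" and k :: nat
    assume "\<And>n. n < k \<Longrightarrow> f n = g n"
    then have "z f k = z g k" unfolding z_def by (intro sum.cong) auto
    then show "(r \<in> C k \<and> (\<forall>v\<in>C k. norm (z f k + q ^ k *\<^sub>R r) \<le> norm (z f k + q ^ k *\<^sub>R v) + e k)) =
      (r \<in> C k \<and> (\<forall>v\<in>C k. norm (z g k + q ^ k *\<^sub>R r) \<le> norm (z g k + q ^ k *\<^sub>R v) + e k))" by simp
  next
    fix k and y :: "nat \<Rightarrow> 'a"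
    let ?n = "\<lambda>v. norm (z y k + q ^ k *\<^sub>R v)"
    have bdd: "bdd_below (?n ` C k)" by (intro bdd_belowI[of _ 0]) auto
    have "\<exists>v\<in>C k. ?n v < Inf (?n ` C k) + e k"
      using cInf_lessD[of "?n ` C k" "Inf (?n ` C k) + e k"] C_mem[of k] e_pos[of k] by fastforce
    then obtain v where v: "v \<in> C k" "?n v < Inf (?n ` C k) + e k" by blast
    have "?n v \<le> ?n v' + e k" if "v' \<in> C k" for v'
      using cINF_lower[OF bdd that] v(2) by linarith
    with v(1) show "\<exists>v. v \<in> C k \<and> (\<forall>v'\<in>C k. ?n v \<le> ?n v' + e k)" by blast
  qed
  then obtain y where y: "\<And>k. y k \<in> C k"
    "\<And>k v. v \<in> C k \<Longrightarrow> norm (z y k + q ^ k *\<^sub>R y k) \<le> norm (z y k + q ^ k *\<^sub>R v) + e k" by blast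
  define x where "x = (\<Sum>n. q ^ n *\<^sub>R y n)"
  \<comment> \<open>The competitor for \<open>y k\<close>: the normalized remainder of the series from position \<open>k\<close> on.\<close>
  define v where "v k = (1 - q) *\<^sub>R (\<Sum>n. q ^ n *\<^sub>R y (n + k))" for k
  have y_tail: "y (n + k) \<in> C k" for n k
    using y(1)[of "n + k"] C_antimono[of k "n + k"] by auto
  have summ: "summable (\<lambda>n. q ^ n *\<^sub>R y (n + k))" and vC: "v k \<in> C k" for k
    using geometric_average_in_closed_convex[of "C k" "\<lambda>n. y (n + k)" q] C y_tail q(1,2)
    unfolding v_def by simp_all
  have v_eq: "q ^ k *\<^sub>R v k = (1 - q) *\<^sub>R (x - z y k)" for k
  proof -
    have "x = (\<Sum>n. q ^ (n + k) *\<^sub>R y (n + k)) + z y k"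
      unfolding x_def z_def using summ[of 0] by (intro suminf_split_initial_segment) simp
    also have "(\<Sum>n. q ^ (n + k) *\<^sub>R y (n + k)) = q ^ k *\<^sub>R (\<Sum>n. q ^ n *\<^sub>R y (n + k))"
      using suminf_scaleR_right[OF summ, of "q ^ k" k] by (simp add: power_add mult.commute)
    finally show ?thesis by (simp add: v_def mult.commute)
  qed
  have step: "norm x - norm (z y (Suc k)) \<ge> q * (norm x - norm (z y k)) - e k" for k
  proof -
    have "norm (z y (Suc k)) = norm (z y k + q ^ k *\<^sub>R y k)" by (simp add: z_def)
    also have "\<dots> \<le> norm (z y k + q ^ k *\<^sub>R v k) + e k" by (rule y(2)[OF vC])
    also have "z y k + q ^ k *\<^sub>R v k = q *\<^sub>R z y k + (1 - q) *\<^sub>R x"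
      unfolding v_eq by (simp add: algebra_simps)
    also have "norm \<dots> \<le> q * norm (z y k) + (1 - q) * norm x"
      using norm_triangle_ineq[of "q *\<^sub>R z y k" "(1 - q) *\<^sub>R x"] q by simp
    finally show ?thesis by (simp add: algebra_simps)
  qed
  have gap: "norm x - norm (z y k) \<ge> q ^ k * (norm x - \<delta> * (1 - (1 / 2) ^ k))" for k
  proof (induction k)
    case 0
    show ?case by (simp add: z_def)
  next
    case (Suc k)
    have "q ^ Suc k * (norm x - \<delta> * (1 - (1 / 2) ^ Suc k))
      = q * (q ^ k * (norm x - \<delta> * (1 - (1 / 2) ^ k))) - e k"
      by (simp add: e_def power_divide field_simps)
    also have "\<dots> \<le> q * (norm x - norm (z y k)) - e k"
      using Suc q(1) by simp
    also note step
    finally show ?case .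
  qed
  \<comment> \<open>The norm of \<open>x\<close> is attained at \<open>b\<close>, and the three summands of \<open>x\<close> before, at and after
    position \<open>N\<close> are estimated separately.\<close>
  obtain b where b: "b \<in> B" "blinfun_apply b x = norm x" "norm b = 1"
    using boundary unfolding is_boundary_def by force
  have b_le: "blinfun_apply b v \<le> norm v" for v
    using norm_blinfun[of b v] b(3) by simp
  obtain N where N: "\<And>n. n \<ge> N \<Longrightarrow> blinfun_apply b (w n) \<le> m'"
    using ev[OF b(1)] by blast
  have "C N \<subseteq> {v. blinfun_apply b v \<le> m'}"
  proof (rule C_minimal)
    show "closed {v. blinfun_apply b v \<le> m'}"
      by (intro closed_Collect_le continuous_intros)
    show "convex {v. blinfun_apply b v \<le> m'}"
      by (auto simp: convex_def blinfun.add_right blinfun.scaleR_right intro: convex_bound_le)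
  qed (use N in auto)
  then have by_le: "blinfun_apply b (y N) \<le> m'" using y(1) by blast
  have "norm x = blinfun_apply b (z y N) + q ^ N * blinfun_apply b (y N) + blinfun_apply b (x - z y (Suc N))"
    using b(2) by (simp add: z_def blinfun.add_right blinfun.diff_right blinfun.scaleR_right)
  also have "\<dots> \<le> norm (z y N) + q ^ N * m' + norm (x - z y (Suc N))"
    using by_le q(1) by (intro add_mono b_le mult_left_mono) auto
  also have "norm (x - z y (Suc N)) = q ^ Suc N * norm (v (Suc N)) / (1 - q)"
  proof -
    have "norm (q ^ Suc N *\<^sub>R v (Suc N)) = norm ((1 - q) *\<^sub>R (x - z y (Suc N)))"
      by (simp only: v_eq)
    then show ?thesis using q by (simp add: eq_divide_eq mult.commute)
  qed
  also have "\<dots> \<le> q ^ Suc N * M / (1 - q)"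
    using C_norm[OF vC] q by (intro divide_right_mono mult_left_mono) auto
  finally have "norm x - norm (z y N) \<le> q ^ N * (m' + q * M / (1 - q))"
    by (simp add: algebra_simps)
  moreover have "q ^ N * (norm x - \<delta>) \<le> q ^ N * (norm x - \<delta> * (1 - (1 / 2) ^ N))"
    using q(1) \<open>\<delta> > 0\<close> by (intro mult_left_mono diff_left_mono) auto
  ultimately have "q ^ N * (norm x - \<delta>) \<le> q ^ N * (m' + q * M / (1 - q))"
    using gap[of N] by linarith
  then have "norm x - \<delta> \<le> m' + q * M / (1 - q)"
    using q(1) by simp
  moreover have "m / (1 - q) \<le> norm x"
  proof -
    have "v 0 = (1 - q) *\<^sub>R x" using v_eq[of 0] by (simp add: z_def)
    then show ?thesis using C_ge[OF vC[of 0]] q by (simp add: divide_le_eq mult.commute)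
  qed
  ultimately have "m / (1 - q) - \<delta> \<le> m' + q * M / (1 - q)" by linarith
  then have "(m / (1 - q) - \<delta>) * (1 - q) \<le> (m' + q * M / (1 - q)) * (1 - q)"
    using q(2) by (intro mult_right_mono) auto
  moreover have "(m / (1 - q) - \<delta>) * (1 - q) = m - \<delta> * (1 - q)"
    and "(m' + q * M / (1 - q)) * (1 - q) = m' * (1 - q) + q * M"
    using q(2) by (simp_all add: left_diff_distrib distrib_right)
  ultimately have "m - \<delta> * (1 - q) \<le> m' * (1 - q) + q * M" by simp
  moreover have "m' = m - 2 * \<delta>" by (simp add: \<delta>_def field_simps)
  ultimately show False using q(3) by (simp add: algebra_simps)
qed

section \<open>Helly's theorem and failure of interchangeable limits\<close>

text \<open>
  Helly's theorem. Let \<open>D\<close> be the infimum over the unit ball of the squared Euclidean distance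
  between \<open>(\<Phi>\<^sub>i f)\<^sub>i\<close> and \<open>c\<close>; the claim is \<open>D = 0\<close>. Otherwise an almost minimal \<open>f\<close> gives the
  residual \<open>a = c - \<Phi> f\<close>, and \<open>F = \<Sum> a\<^sub>i \<Phi>\<^sub>i\<close> is nearly maximal on the unit ball at \<open>f\<close>, as moving from
  \<open>f\<close> a small step towards any \<open>g\<close> hardly decreases the distance. Then
  \<open>\<Sum> a\<^sub>i c\<^sub>i = F f + \<parallel>a\<parallel>\<^sup>2 \<ge> F f + D\<close> exceeds \<open>\<parallel>F\<parallel>\<close>. Almost minimality suffices because the image of
  the ball is bounded.
\<close>

lemma helly_approximation:
  fixes \<Phi> :: "'i \<Rightarrow> ('b::real_normed_vector \<Rightarrow>\<^sub>L real)" and c :: "'i \<Rightarrow> real"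
  assumes fin: "finite I"
    and dom: "\<And>a. (\<Sum>i\<in>I. a i * c i) \<le> norm (\<Sum>i\<in>I. a i *\<^sub>R \<Phi> i)"
    and "e > 0"
  shows "\<exists>f. norm f \<le> 1 \<and> (\<forall>i\<in>I. \<bar>blinfun_apply (\<Phi> i) f - c i\<bar> < e)"
proof -
  define Q where "Q f = (\<Sum>i\<in>I. (c i - blinfun_apply (\<Phi> i) f)\<^sup>2)" for f
  define D where "D = Inf (Q ` cball 0 1)"
  have Q_nonneg: "0 \<le> Q f" for f
    unfolding Q_def by (intro sum_nonneg) simp
  have bdd: "bdd_below (Q ` cball 0 1)"
    using Q_nonneg by (intro bdd_belowI[of _ 0]) auto
  have D_le: "D \<le> Q f" if "norm f \<le> 1" for f
    unfolding D_def by (rule cINF_lower[OF bdd]) (use that in simp)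
  have near: "\<exists>f. norm f \<le> 1 \<and> Q f < D + \<tau>" if "\<tau> > 0" for \<tau>
    using cInf_lessD[of "Q ` cball 0 1" "D + \<tau>"] that unfolding D_def by fastforce
  have "D \<le> 0"
  proof (rule ccontr)
    assume "\<not> D \<le> 0"
    then have "D > 0" by simp
    define R where "R = (\<Sum>i\<in>I. (2 * norm (\<Phi> i))\<^sup>2)"
    have "R \<ge> 0" unfolding R_def by (intro sum_nonneg) simp
    \<comment> \<open>\<open>R\<close> bounds \<open>\<Sum> (\<Phi>\<^sub>i (g - f))\<^sup>2\<close> on the ball. With step length \<open>t\<close> and excess \<open>t D\<close> of
      \<open>Q f\<close> over the infimum, the error in the maximality of \<open>F\<close> at \<open>f\<close> is
      \<open>s = D / 2 + t R / 2\<close>; the choice of \<open>t\<close> makes it smaller than \<open>D\<close>.\<close>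
    define t where "t = min 1 (D / (R + 1))"
    have t: "0 < t" "t \<le> 1" "t * (R + 1) \<le> D"
    proof -
      have "t \<le> D / (R + 1)" by (simp add: t_def)
      then show "t * (R + 1) \<le> D" using \<open>R \<ge> 0\<close> by (simp add: pos_le_divide_eq)
    qed (use \<open>D > 0\<close> \<open>R \<ge> 0\<close> in \<open>simp_all add: t_def\<close>)
    obtain f where f: "norm f \<le> 1" "Q f < D + t * D"
      using near[of "t * D"] t(1) \<open>D > 0\<close> by auto
    define a where "a i = c i - blinfun_apply (\<Phi> i) f" for i
    define F where "F = (\<Sum>i\<in>I. a i *\<^sub>R \<Phi> i)"
    define s where "s = D / 2 + t * R / 2"
    have "t * R < D" using t by (simp add: algebra_simps)
    then have "s < D" by (simp add: s_def)
    have F_ball: "blinfun_apply F g \<le> blinfun_apply F f + s" if g: "norm g \<le> 1" for g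
    proof -
      define h where "h i = blinfun_apply (\<Phi> i) g - blinfun_apply (\<Phi> i) f" for i
      have "(\<Sum>i\<in>I. (h i)\<^sup>2) \<le> R"
        unfolding R_def
      proof (rule sum_mono)
        fix i
        have "\<bar>h i\<bar> = \<bar>blinfun_apply (\<Phi> i) (g - f)\<bar>" by (simp add: h_def blinfun.diff_right)
        also have "\<dots> \<le> norm (\<Phi> i) * norm (g - f)"
          using norm_blinfun[of "\<Phi> i" "g - f"] by simp
        also have "\<dots> \<le> norm (\<Phi> i) * 2"
          using norm_triangle_ineq4[of g f] f(1) g by (intro mult_left_mono) auto
        finally have "\<bar>h i\<bar> \<le> \<bar>2 * norm (\<Phi> i)\<bar>" by simp
        then show "(h i)\<^sup>2 \<le> (2 * norm (\<Phi> i))\<^sup>2" by (simp only: abs_le_square_iff)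
      qed
      have expand: "c i - blinfun_apply (\<Phi> i) ((1 - t) *\<^sub>R f + t *\<^sub>R g) = a i - t * h i" for i
        by (simp add: a_def h_def blinfun.add_right blinfun.scaleR_right left_diff_distrib right_diff_distrib)
      have "norm ((1 - t) *\<^sub>R f + t *\<^sub>R g) \<le> 1"
        using convexD_alt[OF convex_cball, of f 0 1 g t] f(1) g t by simp
      then have "D \<le> Q ((1 - t) *\<^sub>R f + t *\<^sub>R g)" by (rule D_le)
      also have "\<dots> = (\<Sum>i\<in>I. (a i)\<^sup>2 - 2 * t * (a i * h i) + t\<^sup>2 * (h i)\<^sup>2)"
        unfolding Q_def expand by (simp add: power2_eq_square algebra_simps)
      also have "\<dots> = Q f - 2 * t * (\<Sum>i\<in>I. a i * h i) + t\<^sup>2 * (\<Sum>i\<in>I. (h i)\<^sup>2)"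
        by (simp add: sum.distrib sum_subtractf sum_distrib_left Q_def a_def)
      also have "\<dots> \<le> (D + t * D) - 2 * t * (\<Sum>i\<in>I. a i * h i) + t\<^sup>2 * R"
        using f(2) t(1) \<open>(\<Sum>i\<in>I. (h i)\<^sup>2) \<le> R\<close> by (intro add_mono diff_mono mult_left_mono) auto
      finally have "t * (2 * (\<Sum>i\<in>I. a i * h i)) \<le> t * (D + t * R)"
        by (simp add: power2_eq_square algebra_simps)
      then have "2 * (\<Sum>i\<in>I. a i * h i) \<le> D + t * R"
        using t(1) by (simp only: mult_le_cancel_left_pos)
      moreover have "(\<Sum>i\<in>I. a i * h i) = blinfun_apply F g - blinfun_apply F f"
        by (simp add: F_def h_def blinfun.sum_left blinfun.scaleR_left right_diff_distrib sum_subtractf)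
      ultimately show ?thesis by (simp add: s_def)
    qed
    have "norm F \<le> blinfun_apply F f + s"
    proof (rule norm_blinfun_bound)
      show "0 \<le> blinfun_apply F f + s" using F_ball[of 0] by (simp add: blinfun.zero_right)
      fix v
      show "norm (blinfun_apply F v) \<le> (blinfun_apply F f + s) * norm v"
      proof (cases "v = 0")
        case False
        have "blinfun_apply F v / norm v \<le> blinfun_apply F f + s"
          using F_ball[of "v /\<^sub>R norm v"] False by (simp add: blinfun.scaleR_right divide_inverse mult.commute)
        moreover have "- blinfun_apply F v / norm v \<le> blinfun_apply F f + s"
          using F_ball[of "- (v /\<^sub>R norm v)"] False
          by (simp add: blinfun.scaleR_right blinfun.minus_right divide_inverse mult.commute)
        ultimately show ?thesis using False by (simp add: field_simps abs_le_iff)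
      qed (simp add: blinfun.zero_right)
    qed
    also have "\<dots> < blinfun_apply F f + D" using \<open>s < D\<close> by simp
    also have "\<dots> \<le> blinfun_apply F f + Q f" using D_le[OF f(1)] by simp
    also have "\<dots> = (\<Sum>i\<in>I. a i * blinfun_apply (\<Phi> i) f) + Q f"
      by (simp add: F_def blinfun.sum_left blinfun.scaleR_left)
    also have "\<dots> = (\<Sum>i\<in>I. a i * c i)"
      by (simp add: Q_def a_def power2_eq_square algebra_simps flip: sum.distrib)
    finally show False using dom[of a] by (simp add: F_def)
  qed
  then obtain f where f: "norm f \<le> 1" "Q f < e\<^sup>2"
    using near[of "e\<^sup>2"] \<open>e > 0\<close> by force
  have "\<bar>blinfun_apply (\<Phi> i) f - c i\<bar> < e" if "i \<in> I" for i
  proof -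
    have "(c i - blinfun_apply (\<Phi> i) f)\<^sup>2 \<le> Q f"
      unfolding Q_def by (rule member_le_sum) (use fin that in auto)
    also note f(2)
    finally have "\<bar>c i - blinfun_apply (\<Phi> i) f\<bar>\<^sup>2 < e\<^sup>2" by simp
    then have "\<bar>c i - blinfun_apply (\<Phi> i) f\<bar> < e"
      by (rule power2_less_imp_less) (use \<open>e > 0\<close> in simp)
    then show ?thesis by (simp only: abs_minus_commute)
  qed
  with f(1) show ?thesis by blast
qed

lemma bidual_embedding_add: "bidual_embedding (x + y) = bidual_embedding x + bidual_embedding y"
  by (rule blinfun_eqI) (simp add: blinfun.add_left blinfun.add_right)

lemma bidual_embedding_scaleR: "bidual_embedding (r *\<^sub>R x) = r *\<^sub>R bidual_embedding x"
  by (rule blinfun_eqI) (simp add: blinfun.scaleR_left blinfun.scaleR_right)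

lemma bidual_embedding_sum: "bidual_embedding (sum g S) = (\<Sum>i\<in>S. bidual_embedding (g i))"
  by (rule blinfun_eqI) (simp add: blinfun.sum_left blinfun.sum_right)

text \<open>
  Helly's theorem applied to \<open>z\<close> with target value \<open>d\<close> and to the points of \<open>S\<close> with target value
  \<open>0\<close>. Its hypothesis \<open>a\<^sub>0 d \<le> \<parallel>a\<^sub>0 z + \<Sum> a\<^sub>x x\<parallel>\<close> is the distance bound, scaled by \<open>a\<^sub>0\<close>. The index
  \<open>None\<close> belongs to \<open>z\<close>.
\<close>

lemma almost_annihilating_functional:
  fixes z :: "('a::real_normed_vector \<Rightarrow>\<^sub>L real) \<Rightarrow>\<^sub>L real"
  assumes "finite S" "d \<ge> 0" and dist: "\<And>x. d \<le> norm (z - bidual_embedding x)" and "e > 0"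
  shows "\<exists>f. norm f \<le> 1 \<and> (\<forall>x\<in>S. \<bar>blinfun_apply f x\<bar> < e) \<and> d - e < blinfun_apply z f"
proof -
  define I where "I = insert None (Some ` S)"
  define \<Phi> where "\<Phi> = case_option z bidual_embedding"
  define c where "c = case_option d (\<lambda>x :: 'a. 0)"
  have sum_I: "sum h I = h None + (\<Sum>x\<in>S. h (Some x))" for h :: "'a option \<Rightarrow> 'c::comm_monoid_add"
    unfolding I_def using \<open>finite S\<close> by (subst sum.insert) (auto simp: sum.reindex)
  have "\<exists>f. norm f \<le> 1 \<and> (\<forall>i\<in>I. \<bar>blinfun_apply (\<Phi> i) f - c i\<bar> < e)"
  proof (rule helly_approximation)
    fix a :: "'a option \<Rightarrow> real"
    define v where "v = (\<Sum>x\<in>S. a (Some x) *\<^sub>R x)"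
    have "(\<Sum>i\<in>I. a i * c i) = a None * d" by (simp add: sum_I c_def)
    also have "\<dots> \<le> norm (a None *\<^sub>R z + bidual_embedding v)"
    proof (cases "a None = 0")
      case False
      have "a None * d \<le> \<bar>a None\<bar> * norm (z - bidual_embedding ((- inverse (a None)) *\<^sub>R v))"
        using dist \<open>d \<ge> 0\<close> by (intro mult_mono) auto
      also have "\<dots> = norm (a None *\<^sub>R (z - bidual_embedding ((- inverse (a None)) *\<^sub>R v)))"
        by simp
      also have "a None *\<^sub>R (z - bidual_embedding ((- inverse (a None)) *\<^sub>R v))
          = a None *\<^sub>R z + bidual_embedding v"
        using False by (simp add: bidual_embedding_scaleR scaleR_diff_right del: scaleR_minus_left)
      finally show ?thesis .
    qed simp
    also have "a None *\<^sub>R z + bidual_embedding v = (\<Sum>i\<in>I. a i *\<^sub>R \<Phi> i)"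
      by (simp add: sum_I \<Phi>_def v_def bidual_embedding_sum bidual_embedding_scaleR)
    finally show "(\<Sum>i\<in>I. a i * c i) \<le> norm (\<Sum>i\<in>I. a i *\<^sub>R \<Phi> i)" .
  qed (use assms in \<open>simp_all add: I_def\<close>)
  then obtain f where f: "norm f \<le> 1" "\<And>i. i \<in> I \<Longrightarrow> \<bar>blinfun_apply (\<Phi> i) f - c i\<bar> < e" by blast
  have "\<bar>blinfun_apply f x\<bar> < e" if "x \<in> S" for x
    using f(2)[of "Some x"] that by (simp add: I_def \<Phi>_def c_def)
  moreover have "d - e < blinfun_apply z f"
    using f(2)[of None] by (simp add: I_def \<Phi>_def c_def abs_less_iff)
  ultimately show ?thesis using f(1) by blast
qed

lemma weak_star_closure_approx:
  assumes z: "z \<in> weak_star_topology closure_of (bidual_embedding ` A)" and "finite F" "e > 0"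
  shows "\<exists>x\<in>A. \<forall>f\<in>F. \<bar>blinfun_apply f x - blinfun_apply z f\<bar> < e"
proof -
  define U where "U = {g. \<forall>f\<in>F. blinfun_apply g f \<in> ball (blinfun_apply z f) e}"
  have "openin weak_star_topology U"
    unfolding U_def by (rule strong_operator_topology_basis) (use assms in auto)
  moreover have "z \<in> U" using \<open>e > 0\<close> by (simp add: U_def)
  ultimately obtain x where "x \<in> A" "bidual_embedding x \<in> U"
    using z by (auto simp: in_closure_of)
  then show ?thesis by (auto simp: U_def dist_real_def abs_minus_commute)
qed

text \<open>
  The functionals and points are chosen alternately: \<open>f\<^sub>n\<close> almost annihilates the earlier points and
  nearly witnesses that \<open>z\<close> has distance at least \<open>d\<close>, and then \<open>x\<^sub>n\<close> imitates \<open>z\<close> on all functionals up to \<open>f\<^sub>n\<close>.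
\<close>

lemma double_limit_sequences:
  fixes A :: "'a::real_normed_vector set"
  assumes z: "z \<in> weak_star_topology closure_of (bidual_embedding ` A)"
    and "d \<ge> 0" and dist: "\<And>x. d \<le> norm (z - bidual_embedding x)"
  obtains x :: "nat \<Rightarrow> 'a" and f :: "nat \<Rightarrow> 'a \<Rightarrow>\<^sub>L real"
  where "\<And>n. x n \<in> A" "\<And>n. norm (f n) \<le> 1"
    "\<And>i n. i < n \<Longrightarrow> \<bar>blinfun_apply (f n) (x i)\<bar> < 1 / Suc n"
    "\<And>n. d - 1 / Suc n < blinfun_apply z (f n)"
    "\<And>i n. i \<le> n \<Longrightarrow> \<bar>blinfun_apply (f i) (x n) - blinfun_apply z (f i)\<bar> < 1 / Suc n"
proof -
  define P where "P s n p \<longleftrightarrow> fst p \<in> A \<and> norm (snd p) \<le> 1 \<and>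
      (\<forall>i<n. \<bar>blinfun_apply (snd p) (fst (s i))\<bar> < 1 / Suc n) \<and>
      d - 1 / Suc n < blinfun_apply z (snd p) \<and>
      (\<forall>i<n. \<bar>blinfun_apply (snd (s i)) (fst p) - blinfun_apply z (snd (s i))\<bar> < 1 / Suc n) \<and>
      \<bar>blinfun_apply (snd p) (fst p) - blinfun_apply z (snd p)\<bar> < 1 / Suc n"
    for s :: "nat \<Rightarrow> 'a \<times> ('a \<Rightarrow>\<^sub>L real)" and n p
  have "\<exists>s. \<forall>n. P s n (s n)"
  proof (rule dependent_wellorder_choice)
    show "P s n p = P t n p" if "\<And>i. i < n \<Longrightarrow> s i = t i" for p s t and n :: nat
      using that by (simp add: P_def)
  next
    fix n and s :: "nat \<Rightarrow> 'a \<times> ('a \<Rightarrow>\<^sub>L real)"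
    obtain f where f: "norm f \<le> 1" "\<forall>x\<in>(fst \<circ> s) ` {..<n}. \<bar>blinfun_apply f x\<bar> < 1 / Suc n"
      "d - 1 / Suc n < blinfun_apply z f"
      using almost_annihilating_functional[of "(fst \<circ> s) ` {..<n}" d z "1 / Suc n"] assms(2,3)
      by auto
    obtain x where x: "x \<in> A" "\<forall>g\<in>insert f ((snd \<circ> s) ` {..<n}).
        \<bar>blinfun_apply g x - blinfun_apply z g\<bar> < 1 / Suc n"
      using weak_star_closure_approx[OF z, of "insert f ((snd \<circ> s) ` {..<n})" "1 / Suc n"] by auto
    have "P s n (x, f)" unfolding P_def using f x by auto
    then show "\<exists>p. P s n p" ..
  qed
  then obtain s where s: "\<And>n. P s n (s n)" by blast
  show thesis
  proof (rule that[of "\<lambda>n. fst (s n)" "\<lambda>n. snd (s n)"])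
    show "\<bar>blinfun_apply (snd (s i)) (fst (s n)) - blinfun_apply z (snd (s i))\<bar> < 1 / Suc n"
      if "i \<le> n" for i n
      using s[of n] that unfolding P_def by (cases "i = n") auto
  qed (use s in \<open>auto simp: P_def\<close>)
qed

section \<open>Weak compactness from tails in the boundary topology\<close>

text \<open>
  Evaluation at each \<open>b \<in> B\<close> is \<open>\<sigma>\<^sub>B\<close>-continuous, so closed conditions on its values pass to
  \<open>\<sigma>\<^sub>B\<close>-closures.
\<close>

lemma sigma_closure_evaluation:
  assumes "b \<in> B" and y: "y \<in> sigma_topology B closure_of S"
    and "closed T" and "\<And>s. s \<in> S \<Longrightarrow> blinfun_apply b s \<in> T"
  shows "blinfun_apply b y \<in> T"
proof -
  have "continuous_map (sigma_topology B) euclideanreal ((\<lambda>g. g b) \<circ> (\<lambda>x. \<lambda>b\<in>B. blinfun_apply b x))"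
    unfolding sigma_topology_def
    by (intro continuous_map_pullback continuous_map_product_projection \<open>b \<in> B\<close>)
  also have "(\<lambda>g. g b) \<circ> (\<lambda>x. \<lambda>b\<in>B. blinfun_apply b x) = blinfun_apply b"
    using \<open>b \<in> B\<close> by (auto simp: fun_eq_iff)
  finally have "closedin (sigma_topology B) {x \<in> topspace (sigma_topology B). blinfun_apply b x \<in> T}"
    using \<open>closed T\<close> by (intro closedin_continuous_map_preimage[where Y = euclideanreal]) auto
  moreover have "topspace (sigma_topology B) = UNIV"
    by (auto simp: sigma_topology_def topspace_pullback_topology)
  ultimately have "closedin (sigma_topology B) {x. blinfun_apply b x \<in> T}" by simp
  then have "sigma_topology B closure_of S \<subseteq> {x. blinfun_apply b x \<in> T}"
    using assms(4) by (intro closure_of_minimal) auto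
  then show ?thesis using y by blast
qed

text \<open>
  Each \<open>b(x)\<close> is at least \<open>lim b(y\<^sub>n) - \<epsilon>\<close>, because \<open>x\<close> is \<open>\<epsilon>\<close>-close to the \<open>\<sigma>\<^sub>B\<close>-closed convex
  hulls of arbitrarily late tails. So \<open>b(y\<^sub>n - x)\<close> is eventually below \<open>\<epsilon> + \<eta> / 2\<close>, and Simons'
  inequality for the shifted tail of \<open>y\<^sub>n - x\<close> gives the convex combination.
\<close>

lemma norm_close_convex_combinations:
  fixes y :: "nat \<Rightarrow> 'a::banach"
  assumes boundary: "is_boundary B" and bdd: "bounded (range y)"
    and conv: "\<And>b. b \<in> B \<Longrightarrow> convergent (\<lambda>n. blinfun_apply b (y n))"
    and "\<epsilon> \<ge> 0" "\<eta> > 0"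
    and x: "x \<in> (\<Inter>k\<in>{1..}. (sigma_topology B closure_of (convex hull {y n |n. n \<ge> k}))
                   + (\<lambda>v. \<epsilon> *\<^sub>R v) ` cball 0 1)"
  shows "\<exists>u\<in>convex hull (y ` {k..}). norm (u - x) < \<epsilon> + \<eta>"
proof -
  define w where "w n = - x + y (k + n)" for n
  have "\<exists>u\<in>convex hull (range w). norm u < \<epsilon> + \<eta>"
  proof (rule simons_inequality[OF boundary])
    show "bounded (range w)"
      by (rule bounded_subset[OF bounded_translation[OF bdd, of "- x"]]) (auto simp: w_def)
    show "\<epsilon> + \<eta> / 2 < \<epsilon> + \<eta>" using \<open>\<eta> > 0\<close> by simp
    fix b assume "b \<in> B"
    then have "norm b = 1" using boundary by (auto simp: is_boundary_def)
    obtain l where l: "(\<lambda>n. blinfun_apply b (y n)) \<longlonglongrightarrow> l"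
      using conv[OF \<open>b \<in> B\<close>] by (auto simp: convergent_def)
    obtain N where N: "\<And>n. n \<ge> N \<Longrightarrow> \<bar>blinfun_apply b (y n) - l\<bar> < \<eta> / 4"
      using LIMSEQ_D[OF l, of "\<eta> / 4"] \<open>\<eta> > 0\<close> by auto
    from x have "x \<in> (sigma_topology B closure_of (convex hull {y n |n. n \<ge> Suc N}))
                   + (\<lambda>v. \<epsilon> *\<^sub>R v) ` cball 0 1" by auto
    then obtain v u where x_eq: "x = v + \<epsilon> *\<^sub>R u" and "norm u \<le> 1"
      and v: "v \<in> sigma_topology B closure_of (convex hull {y n |n. n \<ge> Suc N})"
      by (auto simp: set_plus_def)
    have "convex hull {y n |n. n \<ge> Suc N} \<subseteq> {v. blinfun_apply b v \<in> {l - \<eta> / 4..}}"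
    proof (rule hull_minimal)
      have "l - \<eta> / 4 \<le> blinfun_apply b (y n)" if "Suc N \<le> n" for n
        using N[of n] that unfolding abs_less_iff by linarith
      then show "{y n |n. n \<ge> Suc N} \<subseteq> {v. blinfun_apply b v \<in> {l - \<eta> / 4..}}"
        by auto
      have "convex (blinfun_apply b -` {l - \<eta> / 4..})"
        by (intro convex_linear_vimage bounded_linear.linear blinfun.bounded_linear_right convex_real_interval)
      then show "convex {v. blinfun_apply b v \<in> {l - \<eta> / 4..}}" by (simp add: vimage_def)
    qed
    then have "l - \<eta> / 4 \<le> blinfun_apply b v"
      using sigma_closure_evaluation[OF \<open>b \<in> B\<close> v, of "{l - \<eta> / 4..}"] by auto
    moreover have "\<bar>blinfun_apply b u\<bar> \<le> 1"
      using norm_blinfun[of b u] \<open>norm b = 1\<close> \<open>norm u \<le> 1\<close> by simp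
    then have "- \<epsilon> \<le> \<epsilon> * blinfun_apply b u"
      using mult_left_mono[of "-1" "blinfun_apply b u" \<epsilon>] \<open>\<epsilon> \<ge> 0\<close> by simp
    ultimately have low: "l - \<eta> / 4 - \<epsilon> \<le> blinfun_apply b x"
      by (simp add: x_eq blinfun.add_right blinfun.scaleR_right)
    have "blinfun_apply b (w n) \<le> \<epsilon> + \<eta> / 2" if "n \<ge> N" for n
    proof -
      have "blinfun_apply b (w n) = blinfun_apply b (y (k + n)) - blinfun_apply b x"
        by (simp add: w_def blinfun.diff_right)
      then show ?thesis using N[of "k + n"] that low unfolding abs_less_iff by simp
    qed
    then show "\<exists>N. \<forall>n\<ge>N. blinfun_apply b (w n) \<le> \<epsilon> + \<eta> / 2" by blast
  qed
  moreover have "range w = (\<lambda>v. - x + v) ` y ` {k..}"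
  proof -
    have "{k..} = range (\<lambda>n. k + n)" using le_Suc_ex by (auto simp: image_iff)
    then show ?thesis by (auto simp: w_def image_image)
  qed
  then have "convex hull (range w) = (\<lambda>v. - x + v) ` (convex hull (y ` {k..}))"
    by (simp only: convex_hull_translation)
  ultimately show ?thesis by auto
qed

theorem corollary2p12:
  fixes A :: "'a::banach set" and B :: "('a \<Rightarrow>\<^sub>L real) set" and \<epsilon> :: real
  assumes "\<not> contains_copy_of_ell1 TYPE('a)"
    and "is_boundary B"
    and "bounded A"
    and "\<epsilon> \<ge> 0"
    and "\<And>x :: nat \<Rightarrow> 'a. (\<forall>n. x n \<in> A) \<Longrightarrow>
      (\<Inter>k\<in>{1..}. (sigma_topology B closure_of (convex hull {x n |n. n \<ge> k}))
                   + (\<lambda>v. \<epsilon> *\<^sub>R v) ` cball 0 1) \<noteq> {}"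
  shows "weakly_relatively_compact_upto (2 * \<epsilon>) A"
  unfolding weakly_relatively_compact_upto_def
proof (intro conjI ballI \<open>bounded A\<close>)
  fix z assume z: "z \<in> weak_star_topology closure_of (bidual_embedding ` A)"
  define d where "d = infdist z (range bidual_embedding)"
  have "d \<ge> 0" unfolding d_def by (rule infdist_nonneg)
  have dist: "d \<le> norm (z - bidual_embedding x)" for x
    unfolding d_def dist_norm[symmetric] by (rule infdist_le) simp
  obtain x f where x: "\<And>n. x n \<in> A" and f: "\<And>n. norm (f n) \<le> 1"
    and row: "\<And>i n. i < n \<Longrightarrow> \<bar>blinfun_apply (f n) (x i)\<bar> < 1 / Suc n"
    and zf: "\<And>n. d - 1 / Suc n < blinfun_apply z (f n)"
    and col: "\<And>i n. i \<le> n \<Longrightarrow> \<bar>blinfun_apply (f i) (x n) - blinfun_apply z (f i)\<bar> < 1 / Suc n"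
    by (rule double_limit_sequences[OF z \<open>d \<ge> 0\<close> dist]) blast
  have bdd: "bounded (range x)"
    by (rule bounded_subset[OF \<open>bounded A\<close>]) (use x in auto)
  obtain \<rho> where \<rho>: "strict_mono \<rho>"
    and cauchy: "\<And>g :: 'a \<Rightarrow>\<^sub>L real. norm g \<le> 1 \<Longrightarrow> convergent (\<lambda>n. blinfun_apply g (x (\<rho> n)))"
    using rosenthal_ell1[OF assms(1) bdd] by blast
  define y where "y n = x (\<rho> n)" for n
  obtain x0 where x0: "x0 \<in> (\<Inter>k\<in>{1..}. (sigma_topology B closure_of (convex hull {y n |n. n \<ge> k}))
                   + (\<lambda>v. \<epsilon> *\<^sub>R v) ` cball 0 1)"
    using assms(5)[of y] x unfolding y_def by blast
  have "d \<le> 2 * \<epsilon> + \<eta>" if "\<eta> > 0" for \<eta>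
  proof -
    have near: "\<exists>u\<in>convex hull (y ` {k..}). norm (u - x0) < \<epsilon> + \<eta> / 2" for k
    proof (rule norm_close_convex_combinations[OF assms(2) _ _ \<open>\<epsilon> \<ge> 0\<close> _ x0])
      show "bounded (range y)" by (rule bounded_subset[OF bdd]) (auto simp: y_def)
      show "convergent (\<lambda>n. blinfun_apply b (y n))" if "b \<in> B" for b
        unfolding y_def by (rule cauchy) (use that assms(2) in \<open>auto simp: is_boundary_def\<close>)
    qed (use that in simp)
    obtain u where u: "u \<in> convex hull (y ` {0..})" "norm (u - x0) < \<epsilon> + \<eta> / 2"
      using near by blast
    \<comment> \<open>The functionals tend to \<open>0\<close> on every \<open>y\<^sub>i\<close>, hence on the fixed finite combination \<open>u\<close>.\<close>
    have "convex hull (y ` {0..}) \<subseteq> {v. (\<lambda>n. blinfun_apply (f n) v) \<longlonglongrightarrow> 0}"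
    proof (rule hull_minimal)
      show "convex {v. (\<lambda>n. blinfun_apply (f n) v) \<longlonglongrightarrow> 0}"
      proof (rule convexI)
        fix v v' and s t :: real
        assume "v \<in> {v. (\<lambda>n. blinfun_apply (f n) v) \<longlonglongrightarrow> 0}" "v' \<in> {v. (\<lambda>n. blinfun_apply (f n) v) \<longlonglongrightarrow> 0}"
        then have "(\<lambda>n. s * blinfun_apply (f n) v + t * blinfun_apply (f n) v') \<longlonglongrightarrow> s * 0 + t * 0"
          by (intro tendsto_intros) auto
        then show "s *\<^sub>R v + t *\<^sub>R v' \<in> {v. (\<lambda>n. blinfun_apply (f n) v) \<longlonglongrightarrow> 0}"
          by (simp add: blinfun.add_right blinfun.scaleR_right)
      qed
      have "(\<lambda>n. blinfun_apply (f n) (x i)) \<longlonglongrightarrow> 0" for i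
      proof (rule Lim_null_comparison[OF _ LIMSEQ_inverse_real_of_nat])
        show "\<forall>\<^sub>F n in sequentially. norm (blinfun_apply (f n) (x i)) \<le> inverse (real (Suc n))"
          using eventually_gt_at_top[of i]
          by eventually_elim (use row in \<open>simp add: inverse_eq_divide less_imp_le\<close>)
      qed
      then show "y ` {0..} \<subseteq> {v. (\<lambda>n. blinfun_apply (f n) v) \<longlonglongrightarrow> 0}" by (auto simp: y_def)
    qed
    with u(1) have f_u: "(\<lambda>n. blinfun_apply (f n) u) \<longlonglongrightarrow> 0" by blast
    \<comment> \<open>In contrast \<open>f\<^sub>m\<close> is at least almost \<open>d\<close> on combinations of the tail from \<open>m\<close> on: one error
      \<open>1 / (m + 1)\<close> comes from \<open>z(f\<^sub>m)\<close> and another from \<open>f\<^sub>m(y\<^sub>n)\<close>.\<close>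
    have bound: "d - (2 * (1 / Suc m) + blinfun_apply (f m) u) \<le> 2 * \<epsilon> + \<eta>" for m
    proof -
      obtain u' where u': "u' \<in> convex hull (y ` {m..})" "norm (u' - x0) < \<epsilon> + \<eta> / 2"
        using near by blast
      have "convex hull (y ` {m..}) \<subseteq> blinfun_apply (f m) -` {d - 2 * (1 / Suc m)..}"
      proof (rule hull_minimal)
        show "convex (blinfun_apply (f m) -` {d - 2 * (1 / Suc m)..})"
          by (intro convex_linear_vimage bounded_linear.linear blinfun.bounded_linear_right convex_real_interval)
        have "d - 2 * (1 / Suc m) \<le> blinfun_apply (f m) (y n)" if "m \<le> n" for n
        proof -
          have "m \<le> \<rho> n" using that seq_suble[OF \<rho>, of n] by linarith
          then have "1 / Suc (\<rho> n) \<le> 1 / Suc m" by (intro divide_left_mono) auto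
          then show ?thesis using col[OF \<open>m \<le> \<rho> n\<close>] zf[of m] by (simp add: y_def abs_less_iff)
        qed
        then show "y ` {m..} \<subseteq> blinfun_apply (f m) -` {d - 2 * (1 / Suc m)..}" by auto
      qed
      then have "d - 2 * (1 / Suc m) \<le> blinfun_apply (f m) u'" using u'(1) by auto
      moreover have "blinfun_apply (f m) (u' - u) \<le> norm (u' - u)"
        using norm_blinfun[of "f m" "u' - u"] mult_right_mono[OF f[of m] norm_ge_zero[of "u' - u"]]
        by simp
      moreover have "norm (u' - u) \<le> norm (u' - x0) + norm (u - x0)"
        using norm_triangle_ineq4[of "u' - x0" "u - x0"] by simp
      ultimately show ?thesis using u(2) u'(2) by (simp add: blinfun.diff_right)
    qed
    have "(\<lambda>m. d - (2 * (1 / Suc m) + blinfun_apply (f m) u)) \<longlonglongrightarrow> d - (2 * 0 + 0)"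
      using LIMSEQ_inverse_real_of_nat by (intro tendsto_intros f_u) (simp add: inverse_eq_divide)
    then show ?thesis
      using bound by (intro tendsto_upperbound[where F = sequentially]) auto
  qed
  then show "infdist z (range bidual_embedding) \<le> 2 * \<epsilon>"
    unfolding d_def[symmetric] by (rule field_le_epsilon)
qed

end
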